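(* Let $\varepsilon>0$ be such that $\gamma+\varepsilon\in(0,1)$, let $A=A_{Q^*}$, and let $$M:=\sum_{i=0}^\infty \left(\frac{1}{\gamma+\varepsilon}\right)^{2i}(A^i)^T A^i ,$$ a positive definite matrix satisfying $A^T M A=(\gamma+\varepsilon)^2(M-I)$. Let $(Q_k)_{k\ge 0}$ be the iterates of Q-value iteration started at $Q_0\in\mathbb{R}^{|\mathcal S||\mathcal A|}$, and suppose that $Q_0-Q^*\le 0$ holds. Then for any $k\ge 0$, $$\|Q_{k+1}-Q^*\|_M\le(\gamma+\varepsilon)\,\|Q_k-Q^*\|_M,$$ where $\|x\|_M:=\sqrt{x^T M x}$.
   Context: Consider a discounted Markov decision problem with finite state space $\mathcal S=\{1,\dots,|\mathcal S|\}$, finite action space $\mathcal A=\{1,\dots,|\mathcal A|\}$, transition probabilities $P(s'|s,a)$, deterministic reward function $r(s,a,s')$ with $|r(s,a,s')|\le 1$, and discount factor $\gamma\in[0,1)$. Put $R(s,a)=\sum_{s'}P(s'|s,a)\,r(s,a,s')$. For a deterministic policy $\pi:\mathcal S\to\mathcal A$, $Q^\pi(s,a)$ is the expected sum $\sum_{k\ge0}\gamma^k r(s_k,a_k,s_{k+1})$ when $s_0=s$, $a_0=a$ and $a_k=\pi(s_k)$ for $k\ge1$. The optimal Q-function is $Q^*=Q^{\pi^*}$ with $\pi^*$ an optimal deterministic policy; it satisfies the Bellman optimality equation $Q^*(s,a)=R(s,a)+\gamma\sum_{s'}P(s'|s,a)\max_{a'}Q^*(s',a')$, whose solution is unique. Q-functions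 are regarded as vectors in $\mathbb{R}^{|\mathcal S||\mathcal A|}$ indexed by state-action pairs. Inequalities between vectors are entrywise. For $Q\in\mathbb{R}^{|\mathcal S||\mathcal A|}$, the greedy policy is $\pi_Q(s)\in\arg\max_{a\in\mathcal A}Q(s,a)$ (some fixed selection), and $A_Q\in\mathbb{R}^{|\mathcal S||\mathcal A|\times|\mathcal S||\mathcal A|}$ is $\gamma$ times the state-action transition matrix under $\pi_Q$, i.e. its entry in row $(s,a)$ and column $(s',a')$ is $\gamma P(s'|s,a)$ if $a'=\pi_Q(s')$ and $0$ otherwise. Q-value iteration: given $Q_0\in\mathbb{R}^{|\mathcal S||\mathcal A|}$, for $k\ge0$, $Q_{k+1}(s,a)=R(s,a)+\gamma\sum_{s'\in\mathcal S}P(s'|s,a)\max_{a'\in\mathcal A}Q_k(s',a')$. *)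

theory Defs
  imports "HOL-Analysis.Analysis" "HOL-Probability.Probability"
begin

section \<open>Trajectories\<close>

text \<open>
  States and actions range over finite types \<open>'s\<close> and \<open>'a\<close>; \<open>pmf (P s a) s'\<close> is the transition
  probability \<open>P(s'|s,a)\<close>.  A trajectory is the sequence \<open>\<omega>\<close> of its states; its actions are
  determined by the initial action and the policy.
\<close>

definition act :: "('s \<Rightarrow> 'a) \<Rightarrow> 'a \<Rightarrow> (nat \<Rightarrow> 's) \<Rightarrow> nat \<Rightarrow> 'a" where
  "act \<pi> a \<omega> k = (if k = 0 then a else \<pi> (\<omega> k))"

text \<open>Conditional law of the \<open>k\<close>-th state given the previous states \<open>\<omega> 0, \<dots>, \<omega> (k - 1)\<close>.\<close>

primrec traj_kernel ::
  "('s \<Rightarrow> 'a \<Rightarrow> 's pmf) \<Rightarrow> ('s \<Rightarrow> 'a) \<Rightarrow> 's \<Rightarrow> 'a \<Rightarrow> nat \<Rightarrow> (nat \<Rightarrow> 's) \<Rightarrow> 's measure" where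
  "traj_kernel P \<pi> s a 0 = (\<lambda>\<omega>. measure_pmf (return_pmf s))"
| "traj_kernel P \<pi> s a (Suc k) = (\<lambda>\<omega>. measure_pmf (P (\<omega> k) (act \<pi> a \<omega> k)))"

lemma Ionescu_Tulcea_traj_kernel:
  fixes P :: "'s::finite \<Rightarrow> 'a::finite \<Rightarrow> 's pmf"
  shows "Ionescu_Tulcea (traj_kernel P \<pi> s a) (\<lambda>_. count_space UNIV)"
proof (rule Ionescu_Tulcea.intro)
  fix i :: nat
  show "traj_kernel P \<pi> s a i
      \<in> measurable (PiM {0..<i} (\<lambda>_. count_space UNIV)) (subprob_algebra (count_space UNIV))"
  proof (cases i)
    case 0
    then show ?thesis by (simp add: measure_pmf_in_subprob_algebra)
  next
    case (Suc k)
    have *: "(\<lambda>\<omega>. \<omega> k) \<in> measurable (PiM {0..<i} (\<lambda>_. count_space UNIV)) (count_space (UNIV :: 's set))"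
      using Suc by (intro measurable_component_singleton) auto
    have "(\<lambda>x. measure_pmf (P x (if k = 0 then a else \<pi> x)))
      \<in> measurable (count_space (UNIV :: 's set)) (subprob_algebra (count_space UNIV))"
      by (simp add: measure_pmf_in_subprob_algebra)
    from measurable_compose[OF * this] show ?thesis
      by (simp add: Suc act_def)
  qed
next
  fix i :: nat and x :: "nat \<Rightarrow> 's"
  assume "x \<in> space (PiM {0..<i} (\<lambda>_. count_space (UNIV :: 's set)))"
  show "prob_space (traj_kernel P \<pi> s a i x)"
    by (cases i) (simp_all add: measure_pmf.prob_space_axioms)
qed

text \<open>The law of \<open>(s\<^sub>0, s\<^sub>1, \<dots>)\<close>, by the Ionescu-Tulcea theorem.\<close>

definition traj :: "('s \<Rightarrow> 'a \<Rightarrow> 's pmf) \<Rightarrow> ('s \<Rightarrow> 'a) \<Rightarrow> 's \<Rightarrow> 'a \<Rightarrow> (nat \<Rightarrow> 's) measure" where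
  "traj P \<pi> s a = projective_family.lim UNIV
     (Ionescu_Tulcea.CI (traj_kernel P \<pi> s a) (\<lambda>_. count_space UNIV)) (\<lambda>_. count_space UNIV)"

lemma prob_space_traj:
  fixes P :: "'s::finite \<Rightarrow> 'a::finite \<Rightarrow> 's pmf"
  shows "prob_space (traj P \<pi> s a)" and "sets (traj P \<pi> s a) = sets (PiM UNIV (\<lambda>_. count_space UNIV))"
proof -
  interpret Ionescu_Tulcea "traj_kernel P \<pi> s a" "\<lambda>_. count_space UNIV"
    by (rule Ionescu_Tulcea_traj_kernel)
  show "sets (traj P \<pi> s a) = sets (PiM UNIV (\<lambda>_. count_space UNIV))"
    by (simp add: traj_def)
  have "emeasure PF.lim (space PF.lim) = 1"
    using lim[of "{}" "{\<lambda>_. undefined}"] prob_space.emeasure_space_1[OF PF.prob_space_P[of "{}"]]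
    by (simp add: PF.space_lim PF.space_P space_PiM prod_emb_def PiM_empty restrict_def vimage_def)
  then show "prob_space (traj P \<pi> s a)"
    unfolding traj_def by (rule prob_spaceI)
qed

section \<open>Value functions and optimal policies\<close>

definition Qval ::
  "('s::finite \<Rightarrow> 'a::finite \<Rightarrow> 's pmf) \<Rightarrow> ('s \<Rightarrow> 'a \<Rightarrow> 's \<Rightarrow> real) \<Rightarrow> real \<Rightarrow> ('s \<Rightarrow> 'a) \<Rightarrow> real ^ ('s \<times> 'a)"
  where "Qval P r \<gamma> \<pi> = (\<chi> x. case x of (s, a) \<Rightarrow>
    (\<integral>\<omega>. (\<Sum>k. \<gamma> ^ k * r (\<omega> k) (act \<pi> a \<omega> k) (\<omega> (Suc k))) \<partial>traj P \<pi> s a))"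

text \<open>
  A policy is optimal if it maximises the expected discounted return \<open>Q\<^sup>\<pi>(s, \<pi>(s))\<close> obtained by
  following it from every initial state \<open>s\<close>.
\<close>

definition optimal_policy ::
  "('s::finite \<Rightarrow> 'a::finite \<Rightarrow> 's pmf) \<Rightarrow> ('s \<Rightarrow> 'a \<Rightarrow> 's \<Rightarrow> real) \<Rightarrow> real \<Rightarrow> ('s \<Rightarrow> 'a) \<Rightarrow> bool"
  where "optimal_policy P r \<gamma> \<pi> \<longleftrightarrow>
    (\<forall>\<pi>' s. Qval P r \<gamma> \<pi>' $ (s, \<pi>' s) \<le> Qval P r \<gamma> \<pi> $ (s, \<pi> s))"

section \<open>Q-value iteration\<close>

definition reward ::
  "('s::finite \<Rightarrow> 'a \<Rightarrow> 's pmf) \<Rightarrow> ('s \<Rightarrow> 'a \<Rightarrow> 's \<Rightarrow> real) \<Rightarrow> 's \<Rightarrow> 'a \<Rightarrow> real"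
  where "reward P r s a = (\<Sum>s'\<in>UNIV. pmf (P s a) s' * r s a s')"

primrec q_iter ::
  "('s::finite \<Rightarrow> 'a::finite \<Rightarrow> 's pmf) \<Rightarrow> ('s \<Rightarrow> 'a \<Rightarrow> 's \<Rightarrow> real) \<Rightarrow> real
    \<Rightarrow> real ^ ('s \<times> 'a) \<Rightarrow> nat \<Rightarrow> real ^ ('s \<times> 'a)" where
  "q_iter P r \<gamma> Q0 0 = Q0"
| "q_iter P r \<gamma> Q0 (Suc k) = (\<chi> x. case x of (s, a) \<Rightarrow>
     reward P r s a
       + \<gamma> * (\<Sum>s'\<in>UNIV. pmf (P s a) s' * (MAX a'. q_iter P r \<gamma> Q0 k $ (s', a'))))"

definition greedy_selection :: "(real ^ ('s::finite \<times> 'a::finite) \<Rightarrow> 's \<Rightarrow> 'a) \<Rightarrow> bool" where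
  "greedy_selection g \<longleftrightarrow> (\<forall>Q s a. Q $ (s, a) \<le> Q $ (s, g Q s))"

definition policy_matrix ::
  "('s::finite \<Rightarrow> 'a::finite \<Rightarrow> 's pmf) \<Rightarrow> real \<Rightarrow> ('s \<Rightarrow> 'a) \<Rightarrow> real ^ ('s \<times> 'a) ^ ('s \<times> 'a)"
  where "policy_matrix P \<gamma> \<pi> = (\<chi> x y. case (x, y) of ((s, a), (s', a')) \<Rightarrow>
    if a' = \<pi> s' then \<gamma> * pmf (P s a) s' else 0)"

section \<open>The weighted norm\<close>

text \<open>On vector types \<open>^\<close> is the entrywise power, so matrix powers need their own definition.\<close>

primrec matrix_pow :: "real ^ 'n ^ 'n \<Rightarrow> nat \<Rightarrow> real ^ 'n ^ 'n" where
  "matrix_pow A 0 = mat 1"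
| "matrix_pow A (Suc i) = A ** matrix_pow A i"

definition M_term :: "real \<Rightarrow> real ^ 'n ^ 'n \<Rightarrow> nat \<Rightarrow> real ^ 'n ^ 'n" where
  "M_term c A i = (1 / c) ^ (2 * i) *\<^sub>R (transpose (matrix_pow A i) ** matrix_pow A i)"

definition positive_definite :: "real ^ 'n ^ 'n \<Rightarrow> bool" where
  "positive_definite M \<longleftrightarrow> transpose M = M \<and> (\<forall>x. x \<noteq> 0 \<longrightarrow> 0 < x \<bullet> (M *v x))"

definition weighted_norm :: "real ^ 'n ^ 'n \<Rightarrow> real ^ 'n \<Rightarrow> real" where
  "weighted_norm M x = sqrt (x \<bullet> (M *v x))"

end

theory Submission
  imports Defs
begin

text \<open>
  Conditioning on one transition shows that the value \<open>s \<mapsto> Q\<^sup>\<pi>(s, \<pi>(s))\<close> of a policy is a discounted series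
  satisfying the evaluation equation of \<open>\<pi>\<close>.  If \<open>\<pi>\<close> is optimal, changing its action in a single state
  cannot improve it, so \<open>Q\<^sup>*\<close> solves the Bellman optimality equation.  Consequently, by
  monotonicity of the Bellman operator and induction, the errors \<open>x\<^sub>k = Q\<^sub>k - Q\<^sup>*\<close> satisfy
  \<open>A x\<^sub>k \<le> x\<^sub>k\<^sub>+\<^sub>1 \<le> 0\<close>, the lower bound because the action greedy for \<open>Q\<^sup>*\<close> is
  merely one candidate in the maximum of \<open>Q\<^sub>k\<close>.  Since \<open>A\<close> is entrywise nonnegative, so is \<open>M\<close>, and hence
  \<open>\<parallel>x\<^sub>k\<^sub>+\<^sub>1\<parallel>\<^sub>M \<le> \<parallel>A x\<^sub>k\<parallel>\<^sub>M\<close>; the Lyapunov equation bounds the right-hand side by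
  \<open>(\<gamma> + \<epsilon>) \<parallel>x\<^sub>k\<parallel>\<^sub>M\<close>.
\<close>

section \<open>Transitions of the trajectory measure\<close>

text \<open>The first \<open>m\<close> coordinates of the limit have the law \<open>C 0 m\<close>
  built by iterating the kernels, and \<open>C 0 (Suc n)\<close> arises from \<open>C 0 n\<close> by
  binding with \<open>eP n\<close>. Thus the last coordinate can be integrated out against its
  kernel.\<close>

lemma (in Ionescu_Tulcea) nn_integral_lim_Suc:
  assumes f[measurable]: "f \<in> borel_measurable (PiM {0..<Suc n} M)"
  shows "(\<integral>\<^sup>+\<omega>. f (restrict \<omega> {0..<Suc n}) \<partial>PF.lim) =
    (\<integral>\<^sup>+\<omega>. (\<integral>\<^sup>+y. f ((restrict \<omega> {0..<n})(n := y)) \<partial>P n (restrict \<omega> {0..<n})) \<partial>PF.lim)"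
proof -
  \<comment> \<open>\<open>CI J\<close> is a marginal of the law of the first \<open>up_to J\<close>
    coordinates; for an initial segment nothing is projected away.\<close>
  have CI: "CI {0..<m} = C 0 m (\<lambda>_. undefined)" for m
  proof -
    have "up_to {0..<m} = m"
      by (metis finite_atLeastLessThan nat_le_linear order_antisym subset_refl up_to up_to_iff_Ico
          ivl_subset bot_nat_0.extremum le_zero_eq)
    then show ?thesis
      using distr_C[of m m "\<lambda>_. undefined" 0] by (simp add: CI_def)
  qed
  have lim_eq: "(\<integral>\<^sup>+\<omega>. h (restrict \<omega> {0..<m}) \<partial>PF.lim) = (\<integral>\<^sup>+\<omega>. h \<omega> \<partial>C 0 m (\<lambda>_. undefined))"
    if h[measurable]: "h \<in> borel_measurable (PiM {0..<m} M)" for h m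
  proof -
    have r: "(\<lambda>\<omega>. restrict \<omega> {0..<m}) \<in> measurable PF.lim (PiM {0..<m} M)"
      by (simp add: measurable_cong_sets[OF PF.sets_lim refl])
    show ?thesis
      unfolding CI[symmetric] distr_lim[OF finite_atLeastLessThan, symmetric]
      by (rule nn_integral_distr[symmetric, OF r]) (simp add: h)
  qed
  \<comment> \<open>Measurability is clear for the integral against \<open>eP n\<close>, which
    agrees with the inner integral on the space.\<close>
  have meas: "(\<lambda>\<omega>. \<integral>\<^sup>+y. f (fun_upd \<omega> n y) \<partial>P n \<omega>) \<in> borel_measurable (PiM {0..<n} M)"
  proof -
    have "(\<lambda>\<omega>. \<integral>\<^sup>+x. f x \<partial>eP n \<omega>) \<in> borel_measurable (PiM {0..<n} M)"
      by measurable
    then show ?thesis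
      by (rule measurable_cong[THEN iffD1, rotated]) (simp add: nn_integral_eP)
  qed
  have "(\<integral>\<^sup>+\<omega>. f (restrict \<omega> {0..<Suc n}) \<partial>PF.lim) = (\<integral>\<^sup>+\<omega>. f \<omega> \<partial>C 0 (Suc n) (\<lambda>_. undefined))"
    by (rule lim_eq[OF f])
  also have "\<dots> = (\<integral>\<^sup>+\<omega>. (\<integral>\<^sup>+x. f x \<partial>eP n \<omega>) \<partial>C 0 n (\<lambda>_. undefined))"
    by (simp, rule nn_integral_bind[where B="PiM {0..<Suc n} M"])
      (use measurable_eP[of n] in \<open>simp_all add: measurable_cong_sets[OF sets_C refl]\<close>)
  also have "\<dots> = (\<integral>\<^sup>+\<omega>. (\<integral>\<^sup>+y. f (fun_upd \<omega> n y) \<partial>P n \<omega>) \<partial>C 0 n (\<lambda>_. undefined))"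
    by (intro nn_integral_cong nn_integral_eP) (simp_all add: space_C)
  also have "\<dots> = (\<integral>\<^sup>+\<omega>. (\<integral>\<^sup>+y. f ((restrict \<omega> {0..<n})(n := y)) \<partial>P n (restrict \<omega> {0..<n})) \<partial>PF.lim)"
    by (rule lim_eq[OF meas, symmetric])
  finally show ?thesis .
qed

lemma measurable_traj_component[measurable]:
  fixes P :: "'s::finite \<Rightarrow> 'a::finite \<Rightarrow> 's pmf"
  shows "(\<lambda>\<omega>. \<omega> k) \<in> measurable (traj P \<pi> s a) (count_space UNIV)"
  by (simp add: measurable_cong_sets[OF prob_space_traj(2) refl])

text \<open>The kernel at time 0 is the point mass at \<open>s\<close>, so the event has probability
  1.\<close>

lemma traj_initial:
  fixes P :: "'s::finite \<Rightarrow> 'a::finite \<Rightarrow> 's pmf"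
  shows "AE \<omega> in traj P \<pi> s a. \<omega> 0 = s"
proof -
  interpret Ionescu_Tulcea "traj_kernel P \<pi> s a" "\<lambda>_. count_space UNIV"
    by (rule Ionescu_Tulcea_traj_kernel)
  interpret prob_space "traj P \<pi> s a" by (rule prob_space_traj)
  have "(\<integral>\<^sup>+\<omega>. indicator {s} (\<omega> 0) \<partial>traj P \<pi> s a) = (1::ennreal)"
  proof -
    have "(\<lambda>\<omega>. indicator {s} (\<omega> 0)) \<in> borel_measurable (PiM {0..<Suc 0} (\<lambda>_. count_space (UNIV :: 's set)))"
      by (rule measurable_compose[OF measurable_component_singleton]) auto
    from nn_integral_lim_Suc[OF this] show ?thesis
      by (simp add: traj_def[symmetric] emeasure_space_1)
  qed
  also have "(\<integral>\<^sup>+\<omega>. indicator {s} (\<omega> 0) \<partial>traj P \<pi> s a) =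
      (\<integral>\<^sup>+\<omega>. indicator {\<omega>\<in>space (traj P \<pi> s a). \<omega> 0 = s} \<omega> \<partial>traj P \<pi> s a)"
    by (intro nn_integral_cong) (auto split: split_indicator)
  also have "\<dots> = emeasure (traj P \<pi> s a) {\<omega>\<in>space (traj P \<pi> s a). \<omega> 0 = s}"
    by (rule nn_integral_indicator) measurable
  finally show ?thesis
    by (subst AE_iff_emeasure_eq_1) simp_all
qed

text \<open>This is the Markov property: the kernel for the next state reads only the current state
  and, at \<open>k = 0\<close>, the initial action.\<close>

lemma nn_integral_traj_step:
  fixes P :: "'s::finite \<Rightarrow> 'a::finite \<Rightarrow> 's pmf" and f :: "'s \<Rightarrow> 's \<Rightarrow> ennreal"
  shows "(\<integral>\<^sup>+\<omega>. f (\<omega> k) (\<omega> (Suc k)) \<partial>traj P \<pi> s a) =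
    (\<integral>\<^sup>+\<omega>. (\<integral>\<^sup>+y. f (\<omega> k) y \<partial>P (\<omega> k) (act \<pi> a \<omega> k)) \<partial>traj P \<pi> s a)"
proof -
  interpret Ionescu_Tulcea "traj_kernel P \<pi> s a" "\<lambda>_. count_space UNIV"
    by (rule Ionescu_Tulcea_traj_kernel)
  let ?N = "PiM {0..<Suc (Suc k)} (\<lambda>_. count_space (UNIV :: 's set))"
  have "(\<lambda>\<omega>. (\<omega> k, \<omega> (Suc k))) \<in> measurable ?N (count_space UNIV \<Otimes>\<^sub>M count_space UNIV)"
    by (intro measurable_Pair measurable_component_singleton) auto
  then have "(\<lambda>\<omega>. (\<omega> k, \<omega> (Suc k))) \<in> measurable ?N (count_space UNIV)"
    \<comment> \<open>The product of two finite discrete spaces is discrete, so every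
      \<open>f\<close> of the pair is measurable.\<close>
    by (simp add: pair_measure_countable)
  from measurable_compose[OF this, of "\<lambda>(x, y). f x y" borel]
  have "(\<lambda>\<omega>. f (\<omega> k) (\<omega> (Suc k))) \<in> borel_measurable ?N"
    by simp
  from nn_integral_lim_Suc[OF this] show ?thesis
    by (cases k) (simp_all add: traj_def[symmetric] act_def)
qed

text \<open>Adding a bound \<open>c\<close> of \<open>F\<close> makes the integrands nonnegative, so
  the previous lemma applies; \<open>c\<close> cancels because the total mass is 1.\<close>

lemma integral_traj_step:
  fixes P :: "'s::finite \<Rightarrow> 'a::finite \<Rightarrow> 's pmf" and F :: "'s \<Rightarrow> 's \<Rightarrow> real"
  shows "(\<integral>\<omega>. F (\<omega> k) (\<omega> (Suc k)) \<partial>traj P \<pi> s a) =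
    (\<integral>\<omega>. (\<Sum>y\<in>UNIV. pmf (P (\<omega> k) (act \<pi> a \<omega> k)) y * F (\<omega> k) y) \<partial>traj P \<pi> s a)"
proof -
  interpret prob_space "traj P \<pi> s a" by (rule prob_space_traj)
  define c where "c = (\<Sum>x\<in>UNIV. \<Sum>y\<in>UNIV. \<bar>F x y\<bar>)"
  have c: "\<bar>F x y\<bar> \<le> c" for x y
  proof -
    have "\<bar>F x y\<bar> \<le> (\<Sum>y\<in>UNIV. \<bar>F x y\<bar>)" by (rule member_le_sum) auto
    also have "\<dots> \<le> c" unfolding c_def by (rule member_le_sum) (auto intro: sum_nonneg)
    finally show ?thesis .
  qed
  let ?G = "\<lambda>\<omega>. (\<Sum>y\<in>UNIV. pmf (P (\<omega> k) (act \<pi> a \<omega> k)) y * F (\<omega> k) y)"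
  have meas: "(\<lambda>\<omega>. h (\<omega> k) (\<omega> (Suc k))) \<in> borel_measurable (traj P \<pi> s a)" for h :: "'s \<Rightarrow> 's \<Rightarrow> real"
    by measurable
  have measG: "?G \<in> borel_measurable (traj P \<pi> s a)"
    \<comment> \<open>The averaged integrand is a function of the current state alone.\<close>
    using meas[of "\<lambda>x _. \<Sum>y\<in>UNIV. pmf (P x (if k = 0 then a else \<pi> x)) y * F x y"] by (simp add: act_def)
  have G: "\<bar>?G \<omega>\<bar> \<le> c" for \<omega>
  proof -
    have "\<bar>?G \<omega>\<bar> \<le> (\<Sum>y\<in>UNIV. pmf (P (\<omega> k) (act \<pi> a \<omega> k)) y * c)"
      by (rule order_trans[OF sum_abs sum_mono]) (auto simp: abs_mult intro!: mult_left_mono c)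
    then show ?thesis by (simp add: sum_distrib_right[symmetric] sum_pmf_eq_1)
  qed
  have intF: "integrable (traj P \<pi> s a) (\<lambda>\<omega>. F (\<omega> k) (\<omega> (Suc k)))"
    by (rule integrable_const_bound[where B=c]) (use c meas in auto)
  have intG: "integrable (traj P \<pi> s a) ?G"
    by (rule integrable_const_bound[where B=c]) (use G measG in auto)
  have nn: "0 \<le> F x y + c" for x y using c[of x y] by linarith
  have nnG: "0 \<le> ?G \<omega> + c" for \<omega> using G[of \<omega>] by linarith
  have eq: "(\<integral>\<^sup>+y. ennreal (F (\<omega> k) y + c) \<partial>P (\<omega> k) (act \<pi> a \<omega> k)) = ennreal (?G \<omega> + c)" for \<omega>
    by (subst nn_integral_eq_integral)
      (auto simp: nn integrable_measure_pmf_finite integral_measure_pmf_real[where A=UNIV] mult.commute)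
  have "(\<integral>\<omega>. F (\<omega> k) (\<omega> (Suc k)) + c \<partial>traj P \<pi> s a) = (\<integral>\<omega>. ?G \<omega> + c \<partial>traj P \<pi> s a)"
    using intF intG nn_integral_traj_step[where f="\<lambda>x y. ennreal (F x y + c)" and k=k and P=P and \<pi>=\<pi> and s=s and a=a]
    by (subst (1 2) integral_eq_nn_integral) (auto simp: nn nnG eq)
  then show ?thesis
    using intF intG by (simp add: prob_space)
qed

section \<open>Averages over successor states and expectations along a trajectory\<close>

lemma pmf_weighted_sum_mono:
  fixes f g :: "'b::finite \<Rightarrow> real"
  assumes "\<And>y. f y \<le> g y"
  shows "(\<Sum>y\<in>UNIV. pmf p y * f y) \<le> (\<Sum>y\<in>UNIV. pmf p y * g y)"
  by (intro sum_mono mult_left_mono assms) simp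

lemma pmf_weighted_sum_const:
  fixes p :: "'b::finite pmf"
  shows "(\<Sum>y\<in>UNIV. pmf p y * c) = (c::real)"
  by (simp add: sum_distrib_right[symmetric] sum_pmf_eq_1)

lemma abs_pmf_weighted_sum_le:
  fixes p :: "'b::finite pmf" and f :: "'b \<Rightarrow> real"
  assumes "\<And>y. \<bar>f y\<bar> \<le> c"
  shows "\<bar>\<Sum>y\<in>UNIV. pmf p y * f y\<bar> \<le> c"
proof -
  have "\<bar>\<Sum>y\<in>UNIV. pmf p y * f y\<bar> \<le> (\<Sum>y\<in>UNIV. pmf p y * \<bar>f y\<bar>)"
    by (rule order_trans[OF sum_abs]) (simp add: abs_mult)
  also have "\<dots> \<le> c"
    using pmf_weighted_sum_mono[of "\<lambda>y. \<bar>f y\<bar>" "\<lambda>_. c" p] assms by (simp add: pmf_weighted_sum_const)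
  finally show ?thesis .
qed

text \<open>The transition operator of the state chain driven by \<open>\<pi>\<close>; its powers
  give expectations several steps ahead.\<close>

definition policy_op ::
  "('s::finite \<Rightarrow> 'a \<Rightarrow> 's pmf) \<Rightarrow> ('s \<Rightarrow> 'a) \<Rightarrow> ('s \<Rightarrow> real) \<Rightarrow> 's \<Rightarrow> real" where
  "policy_op P \<pi> h x = (\<Sum>y\<in>UNIV. pmf (P x (\<pi> x)) y * h y)"

lemma integral_traj_initial:
  fixes P :: "'s::finite \<Rightarrow> 'a::finite \<Rightarrow> 's pmf" and h :: "'s \<Rightarrow> real"
  shows "(\<integral>\<omega>. h (\<omega> 0) \<partial>traj P \<pi> s a) = h s"
proof -
  interpret prob_space "traj P \<pi> s a" by (rule prob_space_traj)
  have "(\<integral>\<omega>. h (\<omega> 0) \<partial>traj P \<pi> s a) = (\<integral>\<omega>. h s \<partial>traj P \<pi> s a)"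
    using traj_initial[where P=P and \<pi>=\<pi> and s=s and a=a] by (intro integral_cong_AE) auto
  then show ?thesis by (simp add: prob_space)
qed

text \<open>The first transition uses \<open>a\<close>, which may differ from
  \<open>\<pi> s\<close>, and only the later ones are powers of \<open>policy_op\<close>. The
  induction peels off the last transition, replacing \<open>h\<close> by its image, hence
  \<open>h\<close> is arbitrary.\<close>

lemma integral_traj_Suc:
  fixes P :: "'s::finite \<Rightarrow> 'a::finite \<Rightarrow> 's pmf" and h :: "'s \<Rightarrow> real"
  shows "(\<integral>\<omega>. h (\<omega> (Suc k)) \<partial>traj P \<pi> s a) = (\<Sum>y\<in>UNIV. pmf (P s a) y * (policy_op P \<pi> ^^ k) h y)"
proof (induction k arbitrary: h)
  case 0
  have "(\<integral>\<omega>. h (\<omega> (Suc 0)) \<partial>traj P \<pi> s a)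
      = (\<integral>\<omega>. (\<Sum>y\<in>UNIV. pmf (P (\<omega> 0) a) y * h y) \<partial>traj P \<pi> s a)"
    using integral_traj_step[where F="\<lambda>_. h" and k=0 and P=P and \<pi>=\<pi> and s=s and a=a]
    by (simp add: act_def)
  also have "\<dots> = (\<Sum>y\<in>UNIV. pmf (P s a) y * h y)"
    by (rule integral_traj_initial)
  finally show ?case by simp
next
  case (Suc k)
  have "(\<integral>\<omega>. h (\<omega> (Suc (Suc k))) \<partial>traj P \<pi> s a)
      = (\<integral>\<omega>. policy_op P \<pi> h (\<omega> (Suc k)) \<partial>traj P \<pi> s a)"
    using integral_traj_step[where F="\<lambda>_. h" and k="Suc k" and P=P and \<pi>=\<pi> and s=s and a=a]
    by (simp add: act_def policy_op_def)
  also have "\<dots> = (\<Sum>y\<in>UNIV. pmf (P s a) y * (policy_op P \<pi> ^^ k) (policy_op P \<pi> h) y)"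
    by (rule Suc.IH)
  finally show ?case by (simp add: funpow_swap1)
qed

text \<open>Integrating out the successor turns \<open>r\<close> into the mean reward, a function of
  the current state whose expectation is already known.\<close>

lemma integral_traj_reward:
  fixes P :: "'s::finite \<Rightarrow> 'a::finite \<Rightarrow> 's pmf"
  shows "(\<integral>\<omega>. r (\<omega> 0) (act \<pi> a \<omega> 0) (\<omega> (Suc 0)) \<partial>traj P \<pi> s a) = reward P r s a"
    and "(\<integral>\<omega>. r (\<omega> (Suc k)) (act \<pi> a \<omega> (Suc k)) (\<omega> (Suc (Suc k))) \<partial>traj P \<pi> s a)
      = (\<Sum>y\<in>UNIV. pmf (P s a) y * (policy_op P \<pi> ^^ k) (\<lambda>x. reward P r x (\<pi> x)) y)"
proof -
  show "(\<integral>\<omega>. r (\<omega> 0) (act \<pi> a \<omega> 0) (\<omega> (Suc 0)) \<partial>traj P \<pi> s a) = reward P r s a"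
    using integral_traj_step[where F="\<lambda>x. r x a" and k=0 and P=P and \<pi>=\<pi> and s=s and a=a]
      integral_traj_initial[where h="\<lambda>x. reward P r x a" and P=P and \<pi>=\<pi> and s=s and a=a]
    by (simp add: act_def reward_def)
  show "(\<integral>\<omega>. r (\<omega> (Suc k)) (act \<pi> a \<omega> (Suc k)) (\<omega> (Suc (Suc k))) \<partial>traj P \<pi> s a)
      = (\<Sum>y\<in>UNIV. pmf (P s a) y * (policy_op P \<pi> ^^ k) (\<lambda>x. reward P r x (\<pi> x)) y)"
    using integral_traj_step[where F="\<lambda>x. r x (\<pi> x)" and k="Suc k" and P=P and \<pi>=\<pi> and s=s and a=a]
      integral_traj_Suc[where h="\<lambda>x. reward P r x (\<pi> x)" and k=k and P=P and \<pi>=\<pi> and s=s and a=a]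
    by (simp add: act_def reward_def)
qed

section \<open>Policy evaluation and the Bellman optimality equation\<close>

locale discounted_mdp =
  fixes P :: "'s::finite \<Rightarrow> 'a::finite \<Rightarrow> 's pmf"
    and r :: "'s \<Rightarrow> 'a \<Rightarrow> 's \<Rightarrow> real" and \<gamma> :: real
  assumes r_bound: "\<bar>r s a s'\<bar> \<le> 1" and \<gamma>: "0 \<le> \<gamma>" "\<gamma> < 1"
begin

lemma abs_reward_le: "\<bar>reward P r s a\<bar> \<le> 1"
  unfolding reward_def by (rule abs_pmf_weighted_sum_le) (rule r_bound)

lemma abs_policy_op_pow_le: "\<bar>(policy_op P \<pi> ^^ k) (\<lambda>x. reward P r x (\<pi> x)) y\<bar> \<le> 1"
  by (induction k arbitrary: y) (auto simp: abs_reward_le policy_op_def intro: abs_pmf_weighted_sum_le)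

text \<open>A form of the value of \<open>\<pi>\<close> free of trajectories, so that the optimality
  argument is finite-dimensional.\<close>

definition policy_value :: "('s \<Rightarrow> 'a) \<Rightarrow> 's \<Rightarrow> real" where
  "policy_value \<pi> s = (\<Sum>k. \<gamma> ^ k * (policy_op P \<pi> ^^ k) (\<lambda>x. reward P r x (\<pi> x)) s)"

lemma summable_discounted:
  assumes "\<And>k. \<bar>f k\<bar> \<le> 1"
  shows "summable (\<lambda>k. \<gamma> ^ k * (f k :: real))"
proof (rule summable_comparison_test')
  show "summable (\<lambda>k. \<gamma> ^ k)" using \<gamma> by (intro summable_geometric) simp
  show "norm (\<gamma> ^ k * f k) \<le> \<gamma> ^ k" for k
    using \<gamma> assms[of k] by (simp add: abs_mult mult_left_le)
qed

text \<open>Sum and integral may be exchanged because the terms are dominated by the geometric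
  series in \<open>\<gamma>\<close>.\<close>

lemma Qval_eq_suminf:
  "Qval P r \<gamma> \<pi> $ (s, a) = (\<Sum>k. \<gamma> ^ k * (\<integral>\<omega>. r (\<omega> k) (act \<pi> a \<omega> k) (\<omega> (Suc k)) \<partial>traj P \<pi> s a))"
proof -
  interpret prob_space "traj P \<pi> s a" by (rule prob_space_traj)
  have int: "integrable (traj P \<pi> s a) (\<lambda>\<omega>. r (\<omega> k) (act \<pi> a \<omega> k) (\<omega> (Suc k)))" for k
  proof (rule integrable_const_bound[where B=1])
    have "(\<lambda>\<omega>. h (\<omega> k) (\<omega> (Suc k))) \<in> borel_measurable (traj P \<pi> s a)" for h :: "'s \<Rightarrow> 's \<Rightarrow> real"
      by measurable
    from this[of "\<lambda>x. r x (if k = 0 then a else \<pi> x)"]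
    show "(\<lambda>\<omega>. r (\<omega> k) (act \<pi> a \<omega> k) (\<omega> (Suc k))) \<in> borel_measurable (traj P \<pi> s a)"
      by (simp add: act_def)
  qed (simp add: r_bound)
  have "Qval P r \<gamma> \<pi> $ (s, a)
      = (\<integral>\<omega>. (\<Sum>k. \<gamma> ^ k * r (\<omega> k) (act \<pi> a \<omega> k) (\<omega> (Suc k))) \<partial>traj P \<pi> s a)"
    by (simp add: Qval_def)
  also have "\<dots> = (\<Sum>k. \<integral>\<omega>. \<gamma> ^ k * r (\<omega> k) (act \<pi> a \<omega> k) (\<omega> (Suc k)) \<partial>traj P \<pi> s a)"
  proof (rule integral_suminf)
    show "integrable (traj P \<pi> s a) (\<lambda>\<omega>. \<gamma> ^ k * r (\<omega> k) (act \<pi> a \<omega> k) (\<omega> (Suc k)))" for k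
      by (intro integrable_mult_right int)
    show "AE \<omega> in traj P \<pi> s a. summable (\<lambda>k. norm (\<gamma> ^ k * r (\<omega> k) (act \<pi> a \<omega> k) (\<omega> (Suc k))))"
      using summable_discounted[of "\<lambda>k. \<bar>r (\<omega> k) (act \<pi> a \<omega> k) (\<omega> (Suc k))\<bar>" for \<omega>] \<gamma>
      by (simp add: abs_mult r_bound)
    have "(\<integral>\<omega>. \<bar>r (\<omega> k) (act \<pi> a \<omega> k) (\<omega> (Suc k))\<bar> \<partial>traj P \<pi> s a) \<le> 1" for k
      using integral_mono[OF integrable_abs[OF int[of k]], of "\<lambda>_. 1"]
      by (simp add: r_bound prob_space)
    then show "summable (\<lambda>k. \<integral>\<omega>. norm (\<gamma> ^ k * r (\<omega> k) (act \<pi> a \<omega> k) (\<omega> (Suc k))) \<partial>traj P \<pi> s a)"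
      using summable_discounted[of "\<lambda>k. \<integral>\<omega>. \<bar>r (\<omega> k) (act \<pi> a \<omega> k) (\<omega> (Suc k))\<bar> \<partial>traj P \<pi> s a"] \<gamma>
      by (simp add: abs_mult)
  qed
  finally show ?thesis by simp
qed

text \<open>The term at time 0 is the mean reward; each later term is a finite average over the
  first successor, and this average commutes with the series.\<close>

lemma Qval_eq_value:
  "Qval P r \<gamma> \<pi> $ (s, a) = reward P r s a + \<gamma> * (\<Sum>y\<in>UNIV. pmf (P s a) y * policy_value \<pi> y)"
proof -
  let ?e = "\<lambda>k. (policy_op P \<pi> ^^ k) (\<lambda>x. reward P r x (\<pi> x))"
  let ?f = "\<lambda>k. \<integral>\<omega>. r (\<omega> k) (act \<pi> a \<omega> k) (\<omega> (Suc k)) \<partial>traj P \<pi> s a"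
  have "\<bar>?f k\<bar> \<le> 1" for k
    by (cases k) (simp_all add: integral_traj_reward abs_reward_le abs_pmf_weighted_sum_le abs_policy_op_pow_le
        del: funpow.simps)
  then have "summable (\<lambda>k. \<gamma> ^ k * ?f k)"
    by (rule summable_discounted)
  from suminf_split_head[OF this]
  have "Qval P r \<gamma> \<pi> $ (s, a) = ?f 0 + (\<Sum>k. \<gamma> ^ Suc k * ?f (Suc k))"
    by (simp add: Qval_eq_suminf)
  also have "(\<Sum>k. \<gamma> ^ Suc k * ?f (Suc k)) = (\<Sum>k. \<Sum>y\<in>UNIV. \<gamma> * (pmf (P s a) y * (\<gamma> ^ k * ?e k y)))"
    by (simp add: integral_traj_reward sum_distrib_left mult_ac)
  also have "\<dots> = (\<Sum>y\<in>UNIV. \<Sum>k. \<gamma> * (pmf (P s a) y * (\<gamma> ^ k * ?e k y)))"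
    by (intro suminf_sum summable_mult summable_discounted abs_policy_op_pow_le)
  also have "\<dots> = (\<Sum>y\<in>UNIV. \<gamma> * (pmf (P s a) y * policy_value \<pi> y))"
    unfolding policy_value_def
    by (simp add: suminf_mult summable_mult summable_discounted abs_policy_op_pow_le)
  finally show ?thesis
    by (simp add: integral_traj_reward sum_distrib_left)
qed

text \<open>If the initial action is \<open>\<pi> s\<close>, the first transition is also a step of
  \<open>policy_op\<close>, and the two series agree term by term.\<close>

lemma Qval_policy: "Qval P r \<gamma> \<pi> $ (s, \<pi> s) = policy_value \<pi> s"
proof -
  let ?e = "\<lambda>k. (policy_op P \<pi> ^^ k) (\<lambda>x. reward P r x (\<pi> x))"
  have "(\<integral>\<omega>. r (\<omega> k) (act \<pi> (\<pi> s) \<omega> k) (\<omega> (Suc k)) \<partial>traj P \<pi> s (\<pi> s)) = ?e k s" for k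
    by (cases k) (simp_all add: integral_traj_reward policy_op_def)
  then show ?thesis by (simp add: Qval_eq_suminf policy_value_def)
qed

lemma policy_value_eq: "policy_value \<pi> s = reward P r s (\<pi> s) + \<gamma> * (\<Sum>y\<in>UNIV. pmf (P s (\<pi> s)) y * policy_value \<pi> y)"
  using Qval_eq_value[of \<pi> s "\<pi> s"] by (simp add: Qval_policy)

text \<open>A minimum principle: at a minimiser the average is at least the minimum
  \<open>m\<close>, so \<open>\<gamma> * m \<le> m\<close>, which forces \<open>m \<ge> 0\<close> as
  \<open>\<gamma> < 1\<close>.\<close>

lemma discounted_superharmonic_nonneg:
  fixes d :: "'s \<Rightarrow> real"
  assumes "\<And>s. \<gamma> * (\<Sum>y\<in>UNIV. pmf (P s (\<pi> s)) y * d y) \<le> d s"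
  shows "0 \<le> d s"
proof -
  obtain x where x: "\<And>y. d x \<le> d y"
    using ex_is_arg_min_if_finite[of UNIV d] by (auto simp: is_arg_min_linorder)
  have "\<gamma> * d x = \<gamma> * (\<Sum>y\<in>UNIV. pmf (P x (\<pi> x)) y * d x)"
    by (simp add: pmf_weighted_sum_const)
  also have "\<dots> \<le> \<gamma> * (\<Sum>y\<in>UNIV. pmf (P x (\<pi> x)) y * d y)"
    using \<gamma> by (intro mult_left_mono pmf_weighted_sum_mono x) simp_all
  also have "\<dots> \<le> d x" by (rule assms)
  finally have "0 \<le> (1 - \<gamma>) * d x" by (simp add: algebra_simps)
  then have "0 \<le> d x" using \<gamma> by (simp add: zero_le_mult_iff)
  with x[of s] show ?thesis by simp
qed

text \<open>Policy improvement: if \<open>a\<close> beats \<open>\<pi>\<close> at \<open>s\<close>,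
  switching to \<open>a\<close> there worsens no state and strictly improves \<open>s\<close>,
  against optimality.\<close>

lemma optimal_policy_greedy:
  assumes opt: "optimal_policy P r \<gamma> \<pi>"
  shows "Qval P r \<gamma> \<pi> $ (s, a) \<le> policy_value \<pi> s"
proof (rule ccontr)
  let ?Q = "Qval P r \<gamma> \<pi>"
  assume contr: "\<not> ?Q $ (s, a) \<le> policy_value \<pi> s"
  define \<pi>' where "\<pi>' = \<pi>(s := a)"
  define d where "d x = policy_value \<pi>' x - policy_value \<pi> x" for x
  \<comment> \<open>Both values average over the same law \<open>P x (\<pi>' x)\<close> and the
    rewards cancel, so the gain \<open>d\<close> solves an evaluation equation whose source is the
    one-step advantage.\<close>
  have d: "d x = (?Q $ (x, \<pi>' x) - policy_value \<pi> x) + \<gamma> * (\<Sum>y\<in>UNIV. pmf (P x (\<pi>' x)) y * d y)" for x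
    unfolding d_def Qval_eq_value policy_value_eq[of \<pi>' x]
    by (simp add: algebra_simps sum_subtractf)
  \<comment> \<open>The advantage vanishes off \<open>s\<close>, where the policies agree, and is
    positive at \<open>s\<close>.\<close>
  have imp: "0 \<le> ?Q $ (x, \<pi>' x) - policy_value \<pi> x" for x
    using contr by (auto simp: \<pi>'_def Qval_policy)
  have "0 \<le> d x" for x
    by (rule discounted_superharmonic_nonneg[of \<pi>']) (use d imp in \<open>smt (verit)\<close>)
  then have "0 \<le> \<gamma> * (\<Sum>y\<in>UNIV. pmf (P s (\<pi>' s)) y * d y)"
    using \<gamma> by (intro mult_nonneg_nonneg sum_nonneg) simp_all
  with d[of s] contr have "0 < d s" by (simp add: \<pi>'_def)
  moreover have "policy_value \<pi>' s \<le> policy_value \<pi> s"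
    using opt by (metis optimal_policy_def Qval_policy)
  ultimately show False by (simp add: d_def)
qed

text \<open>By the previous lemma the maximum is attained at the action of \<open>\<pi>\<close>, so
  the evaluation equation becomes the optimality equation.\<close>

lemma optimal_Qval_bellman:
  assumes opt: "optimal_policy P r \<gamma> \<pi>"
  defines "Q \<equiv> Qval P r \<gamma> \<pi>"
  shows "Q $ (s, a) = reward P r s a + \<gamma> * (\<Sum>y\<in>UNIV. pmf (P s a) y * (MAX b. Q $ (y, b)))"
proof -
  have "(MAX b. Q $ (y, b)) = policy_value \<pi> y" for y
    unfolding Q_def
  proof (rule Max_eqI)
    show "policy_value \<pi> y \<in> range (\<lambda>b. Qval P r \<gamma> \<pi> $ (y, b))"
      by (rule image_eqI[where x="\<pi> y"]) (simp_all add: Qval_policy)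
  qed (auto simp: optimal_policy_greedy[OF opt])
  then show ?thesis by (simp add: Q_def Qval_eq_value)
qed

end

section \<open>The Lyapunov series of a nonnegative matrix\<close>

lemma matrix_pow_commute: "A ** matrix_pow A i = matrix_pow A i ** A"
  by (induction i) (simp_all add: matrix_mul_assoc)

lemma inner_transpose_mult:
  fixes A B :: "real ^ 'n ^ 'n"
  shows "x \<bullet> ((transpose A ** B ** A) *v x) = (A *v x) \<bullet> (B *v (A *v x))"
proof -
  have "x \<bullet> ((transpose A ** B ** A) *v x) = x \<bullet> (transpose A *v (B *v (A *v x)))"
    by (simp only: matrix_vector_mul_assoc matrix_mul_assoc)
  then show ?thesis
    by (simp only: dot_lmul_matrix[symmetric] vector_transpose_matrix)
qed

lemma matrix_add_rdistrib: "(A + B) ** C = A ** C + B ** C"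
  by (simp add: matrix_matrix_mult_def vec_eq_iff distrib_right sum.distrib)

lemma M_term_0: "M_term c A 0 = mat 1"
  by (simp add: M_term_def transpose_mat)

text \<open>Writing the next power as \<open>matrix_pow A i ** A\<close> exposes the outermost
  factors; summing this congruence yields the Lyapunov equation.\<close>

lemma M_term_Suc: "M_term c A (Suc i) = (1 / c)\<^sup>2 *\<^sub>R (transpose A ** M_term c A i ** A)"
proof -
  have "(1 / c) ^ (2 * Suc i) = (1 / c)\<^sup>2 * (1 / c) ^ (2 * i)"
    by (metis add.commute mult_Suc_right power_add)
  then show ?thesis
    by (simp add: M_term_def matrix_pow_commute matrix_transpose_mul matrix_mul_assoc
        matrix_scalar_ac scalar_matrix_assoc[symmetric])
qed

lemma inner_M_term:
  "x \<bullet> (M_term c A i *v x) = (1 / c) ^ (2 * i) * (norm (matrix_pow A i *v x))\<^sup>2"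
proof -
  have "x \<bullet> ((transpose (matrix_pow A i) ** matrix_pow A i) *v x) = (norm (matrix_pow A i *v x))\<^sup>2"
    using inner_transpose_mult[of x "matrix_pow A i" "mat 1"] by (simp add: power2_norm_eq_inner)
  then show ?thesis
    by (simp add: M_term_def scaleR_matrix_vector_assoc[symmetric])
qed

lemma transpose_M_term: "transpose (M_term c A i) = M_term c A i"
  by (simp add: M_term_def transpose_scalar matrix_transpose_mul)

lemma norm_matrix_le:
  fixes X :: "real ^ 'n ^ 'm"
  shows "norm X \<le> (\<Sum>x\<in>UNIV. \<Sum>y\<in>UNIV. \<bar>X $ x $ y\<bar>)"
proof -
  have "norm X \<le> (\<Sum>x\<in>UNIV. norm (X $ x))"
    unfolding norm_vec_def by (rule L2_set_le_sum) simp
  also have "\<dots> \<le> (\<Sum>x\<in>UNIV. \<Sum>y\<in>UNIV. \<bar>X $ x $ y\<bar>)"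
    by (intro sum_mono norm_le_l1_cart)
  finally show ?thesis .
qed

lemma matrix_pow_nonneg:
  assumes "\<And>x y. 0 \<le> A $ x $ y"
  shows "0 \<le> matrix_pow A i $ x $ y"
  using assms by (induction i arbitrary: x y) (auto simp: mat_def matrix_matrix_mult_def intro!: sum_nonneg)

text \<open>The all-ones vector is an eigenvector of \<open>A\<close> for \<open>\<gamma>\<close>.
  With nonnegativity this bounds every entry of the power by \<open>\<gamma> ^ i\<close>.\<close>

lemma matrix_pow_row_sum:
  assumes "\<And>x. (\<Sum>y\<in>UNIV. A $ x $ y) = \<gamma>"
  shows "(\<Sum>y\<in>UNIV. matrix_pow A i $ x $ y) = \<gamma> ^ i"
proof (induction i arbitrary: x)
  case 0
  show ?case by (simp add: mat_def)
next
  case (Suc i)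
  have "(\<Sum>y\<in>UNIV. matrix_pow A (Suc i) $ x $ y)
      = (\<Sum>z\<in>UNIV. A $ x $ z * (\<Sum>y\<in>UNIV. matrix_pow A i $ z $ y))"
    by (simp add: matrix_matrix_mult_def sum_distrib_left) (rule sum.swap)
  then show ?case by (simp add: Suc.IH sum_distrib_right[symmetric] assms)
qed

lemma M_term_nonneg:
  assumes "\<And>x y. 0 \<le> A $ x $ y"
  shows "0 \<le> M_term c A i $ x $ y"
  using matrix_pow_nonneg[OF assms]
  by (auto simp: M_term_def matrix_matrix_mult_def transpose_def power_mult intro!: mult_nonneg_nonneg sum_nonneg)

text \<open>Here \<open>A\<close> is \<open>\<gamma>\<close> times a row-stochastic matrix, and
  \<open>c\<close> stands for \<open>\<gamma> + \<epsilon>\<close>.\<close>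

locale lyapunov_series =
  fixes A :: "real ^ 'n ^ 'n" and \<gamma> c :: real
  assumes nonneg: "0 \<le> A $ x $ y"
    and row_sum: "(\<Sum>y\<in>UNIV. A $ x $ y) = \<gamma>"
    and \<gamma>: "0 \<le> \<gamma>" "\<gamma> < c"
begin

lemma summable_M_term: "summable (M_term c A)"
proof (rule summable_comparison_test')
  let ?N = "real CARD('n)"
  have c: "0 < c" using \<gamma> by simp
  have "(\<gamma> / c)\<^sup>2 < 1"
    using \<gamma> c by (simp add: power_less_one_iff abs_square_less_1)
  \<comment> \<open>One factor \<open>?N\<close> comes from the sum inside the matrix product, the
    other two from adding up all entries.\<close>
  then show "summable (\<lambda>i. ?N * (?N * ?N) * ((\<gamma> / c)\<^sup>2) ^ i)"
    by (intro summable_mult summable_geometric) simp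
  fix i :: nat
  assume "0 \<le> i"
  have pow_le: "matrix_pow A i $ x $ y \<le> \<gamma> ^ i" for x y
    unfolding matrix_pow_row_sum[OF row_sum, of i x, symmetric]
    by (rule member_le_sum) (auto intro: matrix_pow_nonneg nonneg)
  have "\<bar>M_term c A i $ x $ y\<bar> \<le> ?N * ((\<gamma> / c)\<^sup>2) ^ i" for x y
  proof -
    have "M_term c A i $ x $ y = (1 / c) ^ (2 * i) * (\<Sum>z\<in>UNIV. matrix_pow A i $ z $ x * matrix_pow A i $ z $ y)"
      by (simp add: M_term_def matrix_matrix_mult_def transpose_def)
    also have "\<dots> \<le> (1 / c) ^ (2 * i) * (\<Sum>z\<in>(UNIV::'n set). \<gamma> ^ i * \<gamma> ^ i)"
      using \<gamma> c by (intro mult_left_mono sum_mono mult_mono pow_le matrix_pow_nonneg nonneg) auto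
    also have "\<dots> = ?N * ((\<gamma> / c)\<^sup>2) ^ i"
      by (simp add: power_mult[symmetric] power_divide power_add[symmetric] mult_2)
    finally show ?thesis
      using M_term_nonneg[of A c i x y] nonneg by simp
  qed
  then have "(\<Sum>x\<in>UNIV. \<Sum>y\<in>UNIV. \<bar>M_term c A i $ x $ y\<bar>)
      \<le> (\<Sum>x\<in>(UNIV::'n set). \<Sum>y\<in>(UNIV::'n set). ?N * ((\<gamma> / c)\<^sup>2) ^ i)"
    by (intro sum_mono)
  with norm_matrix_le[of "M_term c A i"]
  show "norm (M_term c A i) \<le> ?N * (?N * ?N) * ((\<gamma> / c)\<^sup>2) ^ i"
    by (simp add: mult_ac)
qed

definition M :: "real ^ 'n ^ 'n" where "M = (\<Sum>i. M_term c A i)"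

text \<open>Taking an entry is bounded linear and so passes through the series. The same device
  serves transposition, congruence by \<open>A\<close> and the quadratic form below.\<close>

lemma M_nonneg: "0 \<le> M $ x $ y"
proof -
  have bl: "bounded_linear (\<lambda>X :: real ^ 'n ^ 'n. X $ x $ y)"
    by (rule bounded_linear_compose[OF bounded_linear_vec_nth bounded_linear_vec_nth])
  show ?thesis
    unfolding M_def bounded_linear.suminf[OF bl summable_M_term]
    by (intro suminf_nonneg bounded_linear.summable[OF bl] summable_M_term M_term_nonneg nonneg)
qed

lemma transpose_M: "transpose M = M"
proof -
  have bl: "bounded_linear (transpose :: real ^ 'n ^ 'n \<Rightarrow> _)"
    unfolding linear_conv_bounded_linear[symmetric]
    by (rule linearI) (simp_all add: transpose_def vec_eq_iff)
  show ?thesis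
    unfolding M_def bounded_linear.suminf[OF bl summable_M_term] transpose_M_term ..
qed

text \<open>The term at 0 is the identity, and the recursion makes the tail a scaled congruence of
  the whole series.\<close>

lemma M_split: "M = mat 1 + (1 / c)\<^sup>2 *\<^sub>R (transpose A ** M ** A)"
proof -
  have bl: "bounded_linear (\<lambda>X. transpose A ** X ** A)"
    unfolding linear_conv_bounded_linear[symmetric]
    by (rule linearI)
      (simp_all add: matrix_add_ldistrib matrix_add_rdistrib matrix_scalar_ac scalar_matrix_assoc[symmetric])
  have "M = mat 1 + (\<Sum>i. M_term c A (Suc i))"
    unfolding M_def using suminf_split_head[OF summable_M_term] by (simp add: M_term_0)
  also have "(\<Sum>i. M_term c A (Suc i)) = (1 / c)\<^sup>2 *\<^sub>R (\<Sum>i. transpose A ** M_term c A i ** A)"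
    unfolding M_term_Suc
    by (rule suminf_scaleR_right[symmetric]) (rule bounded_linear.summable[OF bl summable_M_term])
  also have "(\<Sum>i. transpose A ** M_term c A i ** A) = transpose A ** M ** A"
    unfolding M_def by (rule bounded_linear.suminf[OF bl summable_M_term, symmetric])
  finally show ?thesis .
qed

lemma lyapunov_equation: "transpose A ** M ** A = c\<^sup>2 *\<^sub>R (M - mat 1)"
proof -
  have "c\<^sup>2 *\<^sub>R (M - mat 1) = (c\<^sup>2 * (1 / c)\<^sup>2) *\<^sub>R (transpose A ** M ** A)"
    using arg_cong[OF M_split, of "\<lambda>X. c\<^sup>2 *\<^sub>R (X - mat 1)"] by simp
  then show ?thesis using \<gamma> by (simp add: power_divide)
qed

lemma inner_M_nonneg: "0 \<le> x \<bullet> (M *v x)"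
proof -
  have bl: "bounded_linear (\<lambda>X. x \<bullet> (X *v x))"
    unfolding linear_conv_bounded_linear[symmetric]
    by (rule linearI)
      (simp_all add: matrix_vector_mult_add_rdistrib inner_add_right scaleR_matrix_vector_assoc[symmetric])
  show ?thesis
    unfolding M_def bounded_linear.suminf[OF bl summable_M_term]
    by (intro suminf_nonneg bounded_linear.summable[OF bl] summable_M_term)
      (simp add: inner_M_term power_mult)
qed

lemma inner_M_mult: "(A *v x) \<bullet> (M *v (A *v x)) = c\<^sup>2 * (x \<bullet> (M *v x) - x \<bullet> x)"
  unfolding inner_transpose_mult[symmetric] lyapunov_equation
  by (simp add: scaleR_matrix_vector_assoc[symmetric] matrix_vector_mult_diff_rdistrib inner_diff_right)

lemma positive_definite_M: "positive_definite M"
proof -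
  have "0 < x \<bullet> (M *v x)" if "x \<noteq> 0" for x
  proof -
    \<comment> \<open>The form is nonnegative at \<open>A *v x\<close>; through the Lyapunov
      equation this says that \<open>M\<close> dominates the identity.\<close>
    have "0 \<le> c\<^sup>2 * (x \<bullet> (M *v x) - x \<bullet> x)"
      using inner_M_nonneg[of "A *v x"] by (simp add: inner_M_mult)
    then have "x \<bullet> x \<le> x \<bullet> (M *v x)"
      using \<gamma> by (simp add: zero_le_mult_iff)
    with that show ?thesis by (smt (verit) inner_gt_zero_iff)
  qed
  then show ?thesis by (simp add: positive_definite_def transpose_M)
qed

text \<open>As \<open>M\<close> has nonnegative entries, its quadratic form on nonpositive vectors
  grows with the absolute values of the entries. This compares \<open>y\<close> with
  \<open>A *v x\<close>; in the Lyapunov identity the term \<open>x \<bullet> x\<close> is then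
  dropped.\<close>

lemma weighted_norm_contraction:
  assumes "A *v x \<le> y" and "y \<le> 0"
  shows "weighted_norm M y \<le> c * weighted_norm M x"
proof -
  have le: "(A *v x) $ i \<le> y $ i" "y $ i \<le> 0" for i
    using assms by (simp_all add: less_eq_vec_def)
  have prod_le: "y $ i * y $ j \<le> (A *v x) $ i * (A *v x) $ j" for i j
    using mult_mono[of "- y $ i" "- (A *v x) $ i" "- y $ j" "- (A *v x) $ j"] le[of i] le[of j] by simp
  have quad: "z \<bullet> (M *v z) = (\<Sum>i\<in>UNIV. \<Sum>j\<in>UNIV. M $ i $ j * (z $ i * z $ j))" for z
    by (simp add: inner_vec_def matrix_vector_mult_def sum_distrib_left mult_ac)
  have "y \<bullet> (M *v y) \<le> (A *v x) \<bullet> (M *v (A *v x))"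
    unfolding quad
    by (intro sum_mono mult_left_mono M_nonneg prod_le)
  also have "\<dots> \<le> c\<^sup>2 * (x \<bullet> (M *v x))"
    unfolding inner_M_mult by (intro mult_left_mono) simp_all
  finally have "sqrt (y \<bullet> (M *v y)) \<le> sqrt (c\<^sup>2 * (x \<bullet> (M *v x)))"
    by (rule real_sqrt_le_mono)
  then show ?thesis
    using \<gamma> by (simp add: weighted_norm_def real_sqrt_mult)
qed

end

section \<open>Contraction of Q-value iteration\<close>

lemma policy_matrix_mult:
  "(policy_matrix P \<gamma> \<pi> *v x) $ (s, a) = \<gamma> * (\<Sum>y\<in>UNIV. pmf (P s a) y * x $ (y, \<pi> y))"
proof -
  have "(policy_matrix P \<gamma> \<pi> *v x) $ (s, a)
      = (\<Sum>y\<in>UNIV. \<Sum>b\<in>UNIV. (if b = \<pi> y then \<gamma> * pmf (P s a) y else 0) * x $ (y, b))"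
    by (simp add: matrix_vector_mult_def policy_matrix_def sum.cartesian_product UNIV_Times_UNIV
        case_prod_beta cong: if_cong)
  also have "\<dots> = (\<Sum>y\<in>UNIV. \<gamma> * pmf (P s a) y * x $ (y, \<pi> y))"
    by (simp add: if_distrib[of "\<lambda>z. z * _"] cong: if_cong)
  finally show ?thesis by (simp add: sum_distrib_left mult.assoc)
qed

lemma policy_matrix_row_sum: "(\<Sum>y\<in>UNIV. policy_matrix P \<gamma> \<pi> $ x $ y) = \<gamma>"
  \<comment> \<open>The row sums are the entries of the image of the all-ones vector.\<close>
  using policy_matrix_mult[of P \<gamma> \<pi> "\<chi> _. 1" "fst x" "snd x"]
  by (simp add: matrix_vector_mult_def sum_pmf_eq_1)

lemma policy_matrix_nonneg: "0 \<le> \<gamma> \<Longrightarrow> 0 \<le> policy_matrix P \<gamma> \<pi> $ x $ y"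
  by (auto simp: policy_matrix_def split: prod.split)

theorem theorem1:
  fixes P :: "'s::finite \<Rightarrow> 'a::finite \<Rightarrow> 's pmf"
    and r :: "'s \<Rightarrow> 'a \<Rightarrow> 's \<Rightarrow> real"
    and \<gamma> \<epsilon> :: real
    and \<pi>opt :: "'s \<Rightarrow> 'a"
    and g :: "real ^ ('s \<times> 'a) \<Rightarrow> 's \<Rightarrow> 'a"
    and Q0 Qopt :: "real ^ ('s \<times> 'a)"
    and A M :: "real ^ ('s \<times> 'a) ^ ('s \<times> 'a)"
  assumes "\<And>s a s'. \<bar>r s a s'\<bar> \<le> 1"
    and "0 \<le> \<gamma>" and "\<gamma> < 1"
    and "optimal_policy P r \<gamma> \<pi>opt"
    and "Qopt = Qval P r \<gamma> \<pi>opt"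
    and "greedy_selection g"
    and "0 < \<epsilon>" and "\<gamma> + \<epsilon> \<in> {0<..<1}"
    and "A = policy_matrix P \<gamma> (g Qopt)"
    and "M = (\<Sum>i. M_term (\<gamma> + \<epsilon>) A i)"
    and "Q0 - Qopt \<le> 0"
  shows "summable (M_term (\<gamma> + \<epsilon>) A)
    \<and> positive_definite M
    \<and> transpose A ** M ** A = (\<gamma> + \<epsilon>)\<^sup>2 *\<^sub>R (M - mat 1)
    \<and> (\<forall>k. weighted_norm M (q_iter P r \<gamma> Q0 (Suc k) - Qopt)
           \<le> (\<gamma> + \<epsilon>) * weighted_norm M (q_iter P r \<gamma> Q0 k - Qopt))"
proof -
  interpret mdp: discounted_mdp P r \<gamma>
    by unfold_locales (use assms in auto)
  interpret lyap: lyapunov_series A \<gamma> "\<gamma> + \<epsilon>"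
    by unfold_locales (use assms in \<open>auto simp: policy_matrix_row_sum policy_matrix_nonneg\<close>)
  have M: "M = lyap.M"
    unfolding lyap.M_def by (rule assms(10))
  let ?q = "q_iter P r \<gamma> Q0"
  have bellman: "Qopt $ (s, a) = reward P r s a + \<gamma> * (\<Sum>y\<in>UNIV. pmf (P s a) y * (MAX b. Qopt $ (y, b)))" for s a
    unfolding assms(5) by (rule mdp.optimal_Qval_bellman[OF assms(4)])
  have below: "?q k \<le> Qopt" for k
  proof (induction k)
    case 0
    show ?case using assms(11) by simp
  next
    case (Suc k)
    have "(MAX b. ?q k $ (y, b)) \<le> (MAX b. Qopt $ (y, b))" for y
      using Suc.IH by (intro Max.boundedI) (auto simp: less_eq_vec_def intro!: Max_ge_iff[THEN iffD2])
    then have "\<gamma> * (\<Sum>y\<in>UNIV. pmf (P s a) y * (MAX b. ?q k $ (y, b)))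
        \<le> \<gamma> * (\<Sum>y\<in>UNIV. pmf (P s a) y * (MAX b. Qopt $ (y, b)))" for s a
      using \<open>0 \<le> \<gamma>\<close> by (intro mult_left_mono pmf_weighted_sum_mono)
    then have "?q (Suc k) $ (s, a) \<le> Qopt $ (s, a)" for s a
      unfolding bellman[of s a] by simp
    then show ?case
      by (auto simp: less_eq_vec_def simp del: q_iter.simps)
  qed
  have step: "A *v (?q k - Qopt) \<le> ?q (Suc k) - Qopt" for k
  proof -
    \<comment> \<open>The action \<open>g Qopt y\<close> attains the second maximum and is only a
      candidate for the first.\<close>
    have "?q k $ (y, g Qopt y) - Qopt $ (y, g Qopt y) \<le> (MAX b. ?q k $ (y, b)) - (MAX b. Qopt $ (y, b))" for y
    proof (rule diff_mono)
      show "?q k $ (y, g Qopt y) \<le> (MAX b. ?q k $ (y, b))" by simp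
      show "(MAX b. Qopt $ (y, b)) \<le> Qopt $ (y, g Qopt y)"
        using assms(6) by (simp add: greedy_selection_def)
    qed
    then have "\<gamma> * (\<Sum>y\<in>UNIV. pmf (P s a) y * (?q k $ (y, g Qopt y) - Qopt $ (y, g Qopt y)))
        \<le> \<gamma> * (\<Sum>y\<in>UNIV. pmf (P s a) y * ((MAX b. ?q k $ (y, b)) - (MAX b. Qopt $ (y, b))))" for s a
      using \<open>0 \<le> \<gamma>\<close> by (intro mult_left_mono pmf_weighted_sum_mono)
    then have "(A *v (?q k - Qopt)) $ (s, a) \<le> ?q (Suc k) $ (s, a) - Qopt $ (s, a)" for s a
      unfolding assms(9) policy_matrix_mult bellman[of s a]
      by (simp add: right_diff_distrib sum_subtractf)
    then show ?thesis
      by (auto simp: less_eq_vec_def simp del: q_iter.simps)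
  qed
  show ?thesis
    \<comment> \<open>The sign condition of the contraction concerns the new error, so
      \<open>below\<close> enters at \<open>Suc k\<close>.\<close>
    using lyap.summable_M_term lyap.positive_definite_M lyap.lyapunov_equation
      lyap.weighted_norm_contraction[OF step] below
    by (simp add: M del: q_iter.simps)
qed

end
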